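(* Let $n,k$ be positive integers with $n\equiv 0\pmod 4$ and $k\equiv 1\pmod 4$. There exists a Heffter array $H(n;k)$ if at least one of the following holds: (a) $4\lceil (n-4)/12\rceil+5\le k<n$; (b) $n\equiv 0\pmod{12}$ and $5\le k<n$; (c) $n\equiv 0\pmod{16}$ and $5\le k<n$; (d) $n\equiv 4\pmod{16}$ and $5\le k<n$.
   Context: For positive integers $n,k$, a (square integer) Heffter array $H(n;k)$ is an $n\times n$ array of integers, possibly with empty cells, such that: (1) each row and each column contains exactly $k$ filled cells; (2) the entries in every row and in every column sum to $0$ in $\mathbb{Z}$; (3) for every $x\in\{1,2,\ldots,nk\}$ either $x$ or $-x$ appears in the array (so, as there are exactly $nk$ filled cells, exactly one of $x,-x$ appears, exactly once). *)

theory Defs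
  imports Complex_Main
begin

text \<open>
  An \<open>n \<times> n\<close> partially filled array of integers is a function
  \<open>A :: nat \<Rightarrow> nat \<Rightarrow> int option\<close> read only at indices \<open>i, j < n\<close>;
  \<open>A i j = None\<close> means that the cell \<open>(i, j)\<close> is empty.
\<close>

definition row_support :: "nat \<Rightarrow> (nat \<Rightarrow> nat \<Rightarrow> int option) \<Rightarrow> nat \<Rightarrow> nat set" where
  "row_support n A i = {j. j < n \<and> A i j \<noteq> None}"

definition col_support :: "nat \<Rightarrow> (nat \<Rightarrow> nat \<Rightarrow> int option) \<Rightarrow> nat \<Rightarrow> nat set" where
  "col_support n A j = {i. i < n \<and> A i j \<noteq> None}"

text \<open>
  In the last condition the disjunction is inclusive: since there are exactly \<open>n * k\<close> filled
  cells, it already forces exactly one of \<open>x\<close>, \<open>-x\<close> to occur, in exactly one cell.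
\<close>

definition heffter_array :: "nat \<Rightarrow> nat \<Rightarrow> (nat \<Rightarrow> nat \<Rightarrow> int option) \<Rightarrow> bool" where
  "heffter_array n k A \<longleftrightarrow>
     (\<forall>i<n. card (row_support n A i) = k) \<and>
     (\<forall>j<n. card (col_support n A j) = k) \<and>
     (\<forall>i<n. (\<Sum>j\<in>row_support n A i. the (A i j)) = 0) \<and>
     (\<forall>j<n. (\<Sum>i\<in>col_support n A j. the (A i j)) = 0) \<and>
     (\<forall>x\<in>{1..int (n * k)}. \<exists>i<n. \<exists>j<n. A i j = Some x \<or> A i j = Some (- x))"

end

theory Submission
  imports Defs
begin

text \<open>
  Write \<open>n = 4 N\<close> and \<open>k = 5 + 4 s\<close>, so that \<open>s + 2 \<le> N\<close>, and regard the array as an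
  \<open>N \<times> N\<close> array of \<open>4 \<times> 4\<close> blocks, arranged in \<open>N\<close> cyclic block diagonals.

  The block diagonals \<open>0\<close> and \<open>1\<close> together hold five entries per row and column and use up
  \<open>1, \<dots>, 20 N\<close>. As the block row \<open>t\<close> runs through \<open>0, \<dots>, N - 1\<close>, every cell of these blocks runs
  through an interval of length \<open>N\<close> with slope \<open>\<plusminus>1\<close>, or through every second element of an interval
  of length \<open>2 N\<close> with slope \<open>\<plusminus>2\<close>. The slopes cancel in every row of the pair of blocks and in
  every column of each of the two blocks; the latter makes the wrap-around of the cyclic diagonal
  harmless. The table was found by computer search.

  The block diagonals \<open>2, \<dots>, s + 1\<close> are filled with \<open>4 \<times> 4\<close> blocks having two positive and two
  negative entries in each line, which keep their zero line sums when all absolute values are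
  increased by the same amount; so each of them can absorb any \<open>16\<close> consecutive numbers.
\<close>

section \<open>Cyclic block layout and the blocks\<close>

text \<open>\<open>F d t\<close> is the block in block row \<open>t\<close> on cyclic diagonal
  \<open>d\<close>, where \<open>d\<close> is block column minus block row modulo \<open>N\<close>;
  adding \<open>N\<close> first avoids truncated subtraction.\<close>

definition block_array ::
    "nat \<Rightarrow> (nat \<Rightarrow> nat \<Rightarrow> 'a list list) \<Rightarrow> nat \<Rightarrow> nat \<Rightarrow> 'a" where
  "block_array N F r c = F ((c div 4 + N - r div 4) mod N) (r div 4) ! (r mod 4) ! (c mod 4)"

definition main_block :: "int \<Rightarrow> int \<Rightarrow> int option list list" where
  "main_block m t =
    [[Some (- 15 * m + 2 * t + 1), None, Some (- 12 * m - t - 1), Some (20 * m - t)],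
     [Some (6 * m - t), Some (9 * m + 2 * t + 1), None, Some (5 * m - t)],
     [Some (- 8 * m - t - 1), Some (- 6 * m - t - 1), Some (13 * m + 2 * t + 2), None],
     [None, Some (m - t), Some (18 * m - t), Some (- 11 * m + 2 * t)]]"

definition side_block :: "int \<Rightarrow> int \<Rightarrow> int option list list" where
  "side_block m t =
    [[Some (18 * m + t + 1), Some (- 11 * m - t - 1), None, None],
     [None, None, Some (- 4 * m + t), Some (- 16 * m - t - 1)],
     [Some (- m - t - 1), None, None, Some (2 * m + t + 1)],
     [None, Some (7 * m + t + 1), Some (- 15 * m - t - 1), None]]"

definition shift_block :: "int \<Rightarrow> int option list list" where
  "shift_block a =
    [[Some (a + 1), Some (- a - 2), Some (- a - 3), Some (a + 4)],
     [Some (- a - 5), Some (a + 6), Some (a + 7), Some (- a - 8)],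
     [Some (- a - 9), Some (a + 10), Some (a + 11), Some (- a - 12)],
     [Some (a + 13), Some (- a - 14), Some (- a - 15), Some (a + 16)]]"

text \<open>The offset numbers the shifted blocks diagonal by diagonal, so that consecutive blocks
  take consecutive runs of 16 absolute values, starting just above \<open>20 * N\<close>.\<close>

definition heffter_block :: "nat \<Rightarrow> nat \<Rightarrow> nat \<Rightarrow> nat \<Rightarrow> int option list list" where
  "heffter_block N s d t =
    (if d = 0 then main_block (int N) (int t)
     else if d = 1 then side_block (int N) (int t)
     else if d < s + 2 then shift_block (int (20 * N + 16 * (N * (d - 2) + t)))
     else replicate 4 (replicate 4 None))"

section \<open>Counts and sums along the lines of a block array\<close>

abbreviation filled :: "'a option \<Rightarrow> int" where
  "filled x \<equiv> (case x of None \<Rightarrow> 0 | Some _ \<Rightarrow> 1)"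

abbreviation entry :: "int option \<Rightarrow> int" where
  "entry x \<equiv> (case x of None \<Rightarrow> 0 | Some v \<Rightarrow> v)"

lemma less_4_cases:
  fixes i :: nat
  assumes "i < 4"
  obtains "i = 0" | "i = 1" | "i = 2" | "i = 3"
  using assms by linarith

text \<open>Empty cells contribute 0, so the support can be replaced by the full index range, which
  splits into blocks. Counts become integer sums, so the same reindexing serves both counts and
  entries.\<close>

lemma sum_support:
  fixes f :: "nat \<Rightarrow> int option"
  shows "int (card {j. j < n \<and> f j \<noteq> None}) = (\<Sum>j<n. filled (f j))"
    and "(\<Sum>j\<in>{j. j < n \<and> f j \<noteq> None}. the (f j)) = (\<Sum>j<n. entry (f j))"
proof -
  have "int (card {j. j < n \<and> f j \<noteq> None}) = (\<Sum>j\<in>{j. j < n \<and> f j \<noteq> None}. filled (f j))"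
    by (subst sum.cong[OF refl, of _ _ "\<lambda>_. 1"]) auto
  also have "\<dots> = (\<Sum>j<n. filled (f j))"
    by (rule sum.mono_neutral_left) auto
  finally show "int (card {j. j < n \<and> f j \<noteq> None}) = (\<Sum>j<n. filled (f j))" .
  have "(\<Sum>j\<in>{j. j < n \<and> f j \<noteq> None}. the (f j)) = (\<Sum>j\<in>{j. j < n \<and> f j \<noteq> None}. entry (f j))"
    by (rule sum.cong) auto
  also have "\<dots> = (\<Sum>j<n. entry (f j))"
    by (rule sum.mono_neutral_left) auto
  finally show "(\<Sum>j\<in>{j. j < n \<and> f j \<noteq> None}. the (f j)) = (\<Sum>j<n. entry (f j))" .
qed

lemma heffter_array_iff_sum:
  "heffter_array n k A \<longleftrightarrow>
     (\<forall>i<n. (\<Sum>j<n. filled (A i j)) = int k) \<and>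
     (\<forall>j<n. (\<Sum>i<n. filled (A i j)) = int k) \<and>
     (\<forall>i<n. (\<Sum>j<n. entry (A i j)) = 0) \<and>
     (\<forall>j<n. (\<Sum>i<n. entry (A i j)) = 0) \<and>
     (\<forall>x\<in>{1..int (n * k)}. \<exists>i<n. \<exists>j<n. A i j = Some x \<or> A i j = Some (- x))"
  unfolding heffter_array_def row_support_def col_support_def
  unfolding sum_support(1)[symmetric] sum_support(2) of_nat_eq_iff ..

lemma sum_blocks:
  fixes f :: "nat \<Rightarrow> nat \<Rightarrow> int"
  shows "(\<Sum>c<4 * N. f (c div 4) (c mod 4)) = (\<Sum>J<N. \<Sum>j<4. f J j)"
proof -
  have "(\<Sum>c<4 * N. f (c div 4) (c mod 4)) =
      (\<Sum>J<N. \<Sum>c=J * 4..<J * 4 + 4. f (c div 4) (c mod 4))"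
    by (simp add: sum.nat_group mult.commute)
  also have "\<dots> = (\<Sum>J<N. \<Sum>j<4. f J j)"
  proof (rule sum.cong[OF refl])
    fix J
    have J: "c div 4 = J" "J * 4 + c mod 4 = c" if "J * 4 \<le> c" "c < J * 4 + 4" for c :: nat
    proof -
      show "c div 4 = J"
        using that by linarith
      then show "J * 4 + c mod 4 = c"
        using div_mult_mod_eq[of c 4] by simp
    qed
    show "(\<Sum>c=J * 4..<J * 4 + 4. f (c div 4) (c mod 4)) = sum (f J) {..<4}"
      by (rule sum.reindex_bij_witness[of _ "\<lambda>j. J * 4 + j" "\<lambda>c. c mod 4"])
        (auto simp: J)
  qed
  finally show ?thesis .
qed

text \<open>These are the inverse identities that make diagonals correspond bijectively to the
  blocks of a fixed block row, and of a fixed block column.\<close>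

lemma cyclic_diff:
  fixes N d t :: nat
  assumes "d < N" "t < N"
  shows "((t + d) mod N + N - t) mod N = d"
    and "(t + (d + N - t) mod N) mod N = d"
    and "(t + N - (t + N - d) mod N) mod N = d"
  using assms by (auto simp: mod_if)

lemma block_array_row_sum:
  fixes f :: "'a \<Rightarrow> int"
  assumes "r < 4 * N"
  shows "(\<Sum>c<4 * N. f (block_array N F r c)) =
    (\<Sum>d<N. \<Sum>j<4. f (F d (r div 4) ! (r mod 4) ! j))"
proof -
  have t: "r div 4 < N"
    using assms by linarith
  show ?thesis
    unfolding block_array_def
      sum_blocks[of "\<lambda>J j. f (F ((J + N - r div 4) mod N) (r div 4) ! (r mod 4) ! j)"]
    by (rule sum.reindex_bij_witness[of _ "\<lambda>d. (r div 4 + d) mod N" "\<lambda>J. (J + N - r div 4) mod N"])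
      (use t in \<open>auto simp: cyclic_diff\<close>)
qed

lemma block_array_col_sum:
  fixes f :: "'a \<Rightarrow> int"
  assumes "c < 4 * N"
  shows "(\<Sum>r<4 * N. f (block_array N F r c)) =
    (\<Sum>d<N. \<Sum>i<4. f (F d ((c div 4 + N - d) mod N) ! i ! (c mod 4)))"
proof -
  have t: "c div 4 < N"
    using assms by linarith
  show ?thesis
    unfolding block_array_def
      sum_blocks[of "\<lambda>I i. f (F ((c div 4 + N - I) mod N) I ! i ! (c mod 4))"]
    by (rule sum.reindex_bij_witness[of _ "\<lambda>d. (c div 4 + N - d) mod N" "\<lambda>I. (c div 4 + N - I) mod N"])
      (use t in \<open>auto simp: cyclic_diff\<close>)
qed

lemma block_array_hit:
  assumes "d < N" "t < N" "i < 4" "j < 4"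
  shows "\<exists>r<4 * N. \<exists>c<4 * N. block_array N F r c = F d t ! i ! j"
proof (intro exI conjI)
  have "(t + d) mod N < N"
    using assms by simp
  then show "4 * t + i < 4 * N" "4 * ((t + d) mod N) + j < 4 * N"
    using assms by linarith+
  show "block_array N F (4 * t + i) (4 * ((t + d) mod N) + j) = F d t ! i ! j"
    using assms by (simp add: block_array_def cyclic_diff)
qed

section \<open>Line counts and line sums of the chosen blocks\<close>

lemma sum_diagonals:
  fixes G :: "nat \<Rightarrow> int"
  assumes "s + 2 \<le> N"
    and "\<And>d. 2 \<le> d \<Longrightarrow> d < s + 2 \<Longrightarrow> G d = c"
    and "\<And>d. s + 2 \<le> d \<Longrightarrow> G d = 0"
  shows "(\<Sum>d<N. G d) = G 0 + G 1 + int s * c"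
proof -
  have "(\<Sum>d<N. G d) = (\<Sum>d<s + 2. G d)"
    by (rule sum.mono_neutral_right) (use assms in auto)
  also have "{..<s + 2} = {0, 1} \<union> {2..<s + 2}"
    by auto
  also have "(\<Sum>d\<in>\<dots>. G d) = G 0 + G 1 + (\<Sum>d\<in>{2..<s + 2}. G d)"
    by (subst sum.union_disjoint) auto
  also have "(\<Sum>d\<in>{2..<s + 2}. G d) = int s * c"
    using assms(2) by simp
  finally show ?thesis .
qed

lemmas block_simps = main_block_def side_block_def shift_block_def numeral_eq_Suc

lemma main_side_row:
  assumes "i < 4"
  shows "(\<Sum>j<4. filled (main_block m t ! i ! j)) + (\<Sum>j<4. filled (side_block m t ! i ! j)) = 5"
    and "(\<Sum>j<4. entry (main_block m t ! i ! j)) + (\<Sum>j<4. entry (side_block m t ! i ! j)) = 0"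
  by (rule less_4_cases[OF assms]; simp add: block_simps)+

text \<open>The two blocks meeting in a block column come from different block rows, hence separate
  parameters \<open>t\<close> and \<open>u\<close>. Each cancels within its own block, leaving
  opposite terms that depend only on \<open>m\<close>.\<close>

lemma main_side_col:
  assumes "j < 4"
  shows "(\<Sum>i<4. filled (main_block m t ! i ! j)) + (\<Sum>i<4. filled (side_block m u ! i ! j)) = 5"
    and "(\<Sum>i<4. entry (main_block m t ! i ! j)) + (\<Sum>i<4. entry (side_block m u ! i ! j)) = 0"
  by (rule less_4_cases[OF assms]; simp add: block_simps)+

lemma shift_block_line:
  assumes "i < 4"
  shows "(\<Sum>j<4. filled (shift_block a ! i ! j)) = 4"
    and "(\<Sum>j<4. entry (shift_block a ! i ! j)) = 0"
    and "(\<Sum>j<4. filled (shift_block a ! j ! i)) = 4"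
    and "(\<Sum>j<4. entry (shift_block a ! j ! i)) = 0"
  by (rule less_4_cases[OF assms]; simp add: block_simps)+

lemma heffter_block_row:
  assumes "s + 2 \<le> N" "i < 4"
  shows "(\<Sum>d<N. \<Sum>j<4. filled (heffter_block N s d t ! i ! j)) = 5 + 4 * int s"
    and "(\<Sum>d<N. \<Sum>j<4. entry (heffter_block N s d t ! i ! j)) = 0"
  by (subst sum_diagonals[OF assms(1)],
      use assms in \<open>auto simp: heffter_block_def shift_block_line main_side_row\<close>)+

text \<open>Column sums of a block do not depend on its block row, so \<open>u\<close> may be
  arbitrary; in the array it is the block row in which diagonal \<open>d\<close> meets the
  column.\<close>

lemma heffter_block_col:
  assumes "s + 2 \<le> N" "j < 4"
  shows "(\<Sum>d<N. \<Sum>i<4. filled (heffter_block N s d (u d) ! i ! j)) = 5 + 4 * int s"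
    and "(\<Sum>d<N. \<Sum>i<4. entry (heffter_block N s d (u d) ! i ! j)) = 0"
  by (subst sum_diagonals[OF assms(1)],
      use assms in \<open>auto simp: heffter_block_def shift_block_line main_side_col\<close>)+

section \<open>Coverage of all absolute values\<close>

text \<open>Cut the range into 20 intervals of length \<open>m\<close>. Sixteen are each swept by
  one cell of slope 1 or -1; the other four form two adjacent pairs, each shared by two cells of
  slope 2 or -2 according to parity.\<close>

lemma main_side_covers:
  fixes m x :: int
  assumes "x \<in> {1..20 * m}"
  shows "\<exists>t. 0 \<le> t \<and> t < m \<and> (\<exists>i<4. \<exists>j<4.
    main_block m t ! i ! j \<in> {Some x, Some (- x)} \<or> side_block m t ! i ! j \<in> {Some x, Some (- x)})"
    (is "?covered")
proof -
  have main: ?covered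
    if "0 \<le> t" "t < m" "i < 4" "j < 4" "main_block m t ! i ! j \<in> {Some x, Some (- x)}" for t i j
    using that by blast
  have side: ?covered
    if "0 \<le> t" "t < m" "i < 4" "j < 4" "side_block m t ! i ! j \<in> {Some x, Some (- x)}" for t i j
    using that by blast
  define p t where "p = (x - 1) div m" and "t = (x - 1) mod m"
  have m: "m > 0"
    using assms by auto
  have t: "0 \<le> t" "t < m"
    using m by (simp_all add: t_def)
  have x: "x = p * m + t + 1"
    by (simp add: p_def t_def)
  have "0 \<le> p"
    using assms m by (simp add: p_def pos_imp_zdiv_nonneg_iff)
  moreover have "p < 20"
  proof (rule ccontr)
    assume "\<not> p < 20"
    then have "20 * m \<le> p * m"
      using m by simp
    then show False
      using assms t x unfolding atLeastAtMost_iff by linarith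
  qed
  ultimately have "p \<in> set [0..19]"
    by simp
  then have "p \<in> {0, 1, 2, 3, 4, 5, 6, 7, 8, 9, 10, 11, 12, 13, 14, 15, 16, 17, 18, 19}"
    by (simp add: upto_rec1 del: set_upto)
  then consider
      "p = 0" | "p = 1" | "p = 2" | "p = 3" | "p = 4" | "p = 5" | "p = 6" | "p = 7" | "p = 8"
    | "p = 9 \<or> p = 10" | "p = 11" | "p = 12" | "p = 13 \<or> p = 14"
    | "p = 15" | "p = 16" | "p = 17" | "p = 18" | "p = 19"
    by blast
  then show ?thesis
  proof cases
    case 1
    then show ?thesis
      \<comment> \<open>The parameter is \<open>m - 1 - t\<close> for cells whose absolute value
        decreases along the diagonal, and \<open>t\<close> for those where it increases.\<close>
      using x t by (intro main[of "m - 1 - t" 3 1]) (auto simp: block_simps)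
  next
    case 2
    then show ?thesis
      using x t by (intro side[of t 2 0]) (auto simp: block_simps)
  next
    case 3
    then show ?thesis
      using x t by (intro side[of t 2 3]) (auto simp: block_simps)
  next
    case 4
    then show ?thesis
      using x t by (intro side[of "m - 1 - t" 1 2]) (auto simp: block_simps)
  next
    case 5
    then show ?thesis
      using x t by (intro main[of "m - 1 - t" 1 3]) (auto simp: block_simps)
  next
    case 6
    then show ?thesis
      using x t by (intro main[of "m - 1 - t" 1 0]) (auto simp: block_simps)
  next
    case 7
    then show ?thesis
      using x t by (intro main[of t 2 1]) (auto simp: block_simps)
  next
    case 8
    then show ?thesis
      using x t by (intro side[of t 3 1]) (auto simp: block_simps)
  next
    case 9
    then show ?thesis
      using x t by (intro main[of t 2 0]) (auto simp: block_simps)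
  next
    case 10
    \<comment> \<open>In this interval of length \<open>2 * m\<close>, an increasing cell takes the
      odd positions and a decreasing cell the even ones.\<close>
    define h where "h = (x - 1 - 9 * m) div 2"
    have h: "0 \<le> h" "h < m"
      using 10 x t by (auto simp: h_def)
    consider "x = 9 * m + 1 + 2 * h" | "x = 9 * m + 2 + 2 * h"
      unfolding h_def by linarith
    then show ?thesis
    proof cases
      case 1
      then show ?thesis
        using h by (intro main[of "h" 1 1]) (auto simp: block_simps)
    next
      case 2
      then show ?thesis
        using h by (intro main[of "m - 1 - h" 3 3]) (auto simp: block_simps)
    qed
  next
    case 11
    then show ?thesis
      using x t by (intro side[of t 0 1]) (auto simp: block_simps)
  next
    case 12
    then show ?thesis
      using x t by (intro main[of t 0 2]) (auto simp: block_simps)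
  next
    case 13
    \<comment> \<open>Here the decreasing cell takes the odd positions.\<close>
    define h where "h = (x - 1 - 13 * m) div 2"
    have h: "0 \<le> h" "h < m"
      using 13 x t by (auto simp: h_def)
    consider "x = 13 * m + 1 + 2 * h" | "x = 13 * m + 2 + 2 * h"
      unfolding h_def by linarith
    then show ?thesis
    proof cases
      case 1
      then show ?thesis
        using h by (intro main[of "m - 1 - h" 0 0]) (auto simp: block_simps)
    next
      case 2
      then show ?thesis
        using h by (intro main[of "h" 2 2]) (auto simp: block_simps)
    qed
  next
    case 14
    then show ?thesis
      using x t by (intro side[of t 3 2]) (auto simp: block_simps)
  next
    case 15
    then show ?thesis
      using x t by (intro side[of t 1 3]) (auto simp: block_simps)
  next
    case 16
    then show ?thesis
      using x t by (intro main[of "m - 1 - t" 3 2]) (auto simp: block_simps)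
  next
    case 17
    then show ?thesis
      using x t by (intro side[of t 0 0]) (auto simp: block_simps)
  next
    case 18
    then show ?thesis
      using x t by (intro main[of "m - 1 - t" 0 3]) (auto simp: block_simps)
  qed
qed

text \<open>The absolute values increase in reading order, so the offset of \<open>x\<close> written
  in base 4 gives its row and column.\<close>

lemma shift_block_covers:
  fixes a x :: int
  assumes "x \<in> {a + 1..a + 16}"
  shows "\<exists>i<4. \<exists>j<4. shift_block a ! i ! j \<in> {Some x, Some (- x)}"
proof -
  define y i j where "y = nat (x - a - 1)" and "i = y div 4" and "j = y mod 4"
  have y: "x = a + 1 + int y" "y < 16"
    using assms by (auto simp: y_def)
  then have i: "i < 4" and j: "j < 4"
    unfolding i_def j_def by linarith+
  have "y = 4 * i + j"
    by (simp add: i_def j_def)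
  with y have "x = a + 1 + 4 * int i + int j"
    by linarith
  then have "shift_block a ! i ! j \<in> {Some x, Some (- x)}"
    by (cases rule: less_4_cases[OF i]; cases rule: less_4_cases[OF j]) (simp_all add: block_simps)
  then show ?thesis
    using i j by blast
qed

lemma heffter_block_covers:
  fixes x :: int
  assumes "s + 2 \<le> N" "x \<in> {1..int (4 * N * (5 + 4 * s))}"
  shows "\<exists>d<N. \<exists>t<N. \<exists>i<4. \<exists>j<4. heffter_block N s d t ! i ! j \<in> {Some x, Some (- x)}"
proof (cases "x \<le> 20 * int N")
  case True
  then obtain t i j where t: "0 \<le> t" "t < int N" "i < 4" "j < 4"
    and *: "main_block (int N) t ! i ! j \<in> {Some x, Some (- x)} \<or>
      side_block (int N) t ! i ! j \<in> {Some x, Some (- x)}"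
    using main_side_covers[of x "int N"] assms by auto
  then have "heffter_block N s 0 (nat t) ! i ! j \<in> {Some x, Some (- x)} \<or>
      heffter_block N s 1 (nat t) ! i ! j \<in> {Some x, Some (- x)}"
    by (simp add: heffter_block_def)
  moreover have "nat t < N" "0 < N" "1 < N"
    using t assms by auto
  ultimately show ?thesis
    using t by blast
next
  case False
  define y where "y = nat (x - 1 - 20 * int N)"
  have y: "x = 20 * int N + 1 + int y"
    using False by (simp add: y_def)
  \<comment> \<open>The upper bound \<open>4 * N * (5 + 4 * s)\<close> equals
    \<open>20 * N + 16 * (N * s)\<close>.\<close>
  have "int y < int (16 * (N * s))"
    using assms(2) y by (simp add: algebra_simps)
  then have "y < 16 * (N * s)"
    by linarith
  \<comment> \<open>\<open>q\<close> is the number of the shifted block containing \<open>x\<close>;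
    division by \<open>N\<close> then recovers its diagonal and block row.\<close>
  define q where "q = y div 16"
  have q: "q < s * N"
    using \<open>y < 16 * (N * s)\<close> by (simp add: q_def less_mult_imp_div_less mult.commute)
  define d t where "d = q div N + 2" and "t = q mod N"
  have "q div N < s"
    using q by (simp add: less_mult_imp_div_less)
  then have d: "2 \<le> d" "d < s + 2"
    by (simp_all add: d_def)
  have t: "t < N"
    using assms by (simp add: t_def)
  have "N * (d - 2) + t = q"
    by (simp add: d_def t_def)
  then have block: "heffter_block N s d t = shift_block (int (20 * N + 16 * q))"
    using d by (simp add: heffter_block_def)
  have "x \<in> {int (20 * N + 16 * q) + 1..int (20 * N + 16 * q) + 16}"
    unfolding y q_def by auto
  from shift_block_covers[OF this] have
    "\<exists>i<4. \<exists>j<4. heffter_block N s d t ! i ! j \<in> {Some x, Some (- x)}"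
    unfolding block .
  moreover have "d < N"
    using d assms(1) by linarith
  ultimately show ?thesis
    using t by blast
qed

section \<open>Assembly and choice of parameters\<close>

lemma heffter_array_block_array:
  assumes "s + 2 \<le> N"
  shows "heffter_array (4 * N) (5 + 4 * s) (block_array N (heffter_block N s))"
  unfolding heffter_array_iff_sum
proof (intro conjI allI impI ballI)
  fix x :: int
  assume "x \<in> {1..int (4 * N * (5 + 4 * s))}"
  then obtain d t i j where "d < N" "t < N" "i < 4" "j < 4"
    and x: "heffter_block N s d t ! i ! j \<in> {Some x, Some (- x)}"
    using heffter_block_covers[OF assms] by blast
  from block_array_hit[OF this(1-4)] obtain r c where "r < 4 * N" "c < 4 * N"
    "block_array N (heffter_block N s) r c = heffter_block N s d t ! i ! j"
    by blast
  with x show "\<exists>r<4 * N. \<exists>c<4 * N. block_array N (heffter_block N s) r c = Some x \<or>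
      block_array N (heffter_block N s) r c = Some (- x)"
    by (metis insert_iff singletonD)
qed (use assms in \<open>simp_all add: block_array_row_sum block_array_col_sum heffter_block_row heffter_block_col\<close>)

theorem theorem4p13:
  fixes n k :: nat
  assumes "n > 0" and "k > 0"
    and "n mod 4 = 0" and "k mod 4 = 1"
    and "(4 * \<lceil>(real n - 4) / 12\<rceil> + 5 \<le> int k \<and> k < n) \<or>
         (n mod 12 = 0 \<and> 5 \<le> k \<and> k < n) \<or>
         (n mod 16 = 0 \<and> 5 \<le> k \<and> k < n) \<or>
         (n mod 16 = 4 \<and> 5 \<le> k \<and> k < n)"
  shows "\<exists>A. heffter_array n k A"
proof -
  have "4 \<le> n"
    using assms(1,3) by presburger
  \<comment> \<open>This turns the ceiling bound of the first alternative into
    \<open>5 \<le> k\<close>, as in the other three.\<close>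
  then have "0 \<le> \<lceil>(real n - 4) / 12\<rceil>"
    by (simp add: le_ceiling_iff)
  then have k: "5 \<le> k" "k < n"
    using assms(5) by linarith+
  define N s where "N = n div 4" and "s = (k - 5) div 4"
  have "n = 4 * N" "k = 5 + 4 * s"
    using assms(3,4) k unfolding N_def s_def by presburger+
  \<comment> \<open>By integrality, \<open>5 + 4 * s < 4 * N\<close> leaves room for
    \<open>s + 2\<close> block diagonals.\<close>
  moreover from this k have "s + 2 \<le> N"
    by linarith
  ultimately show ?thesis
    using heffter_array_block_array by blast
qed

end
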